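(* Let $(L,\leq,0,1)$ be a bounded lattice with $e\in L\setminus\{0,1\}$. (i) Let $T_e$ be a $t$-norm on $[0,e]$ and let $S_e$ be a $t$-conorm on $[e,1]$. Suppose $x\parallel y$ for all $x\in I_e$ and $y\in[e,1[$. Then the function $U_1^e:L^2\to L$ defined by $$U_1^e(x,y)=\begin{cases} T_e(x,y) & \text{if }(x,y)\in[0,e]^2,\\ S_e(x,y) & \text{if }(x,y)\in[e,1]^2,\\ x & \text{if }(x,y)\in I_e\times[e,1[\,\cup\, I_e\times\,]0,e[,\\ y & \text{if }(x,y)\in[e,1[\,\times I_e\cup\,]0,e[\,\times I_e,\\ x\vee y & \text{if }(x,y)\in I_e^2\cup I_e\times\{1\}\cup\{1\}\times I_e\cup\,]0,e[\,\times\{1\}\cup\{1\}\times\,]0,e[,\\ x\wedge y & \text{otherwise}\end{cases}$$ is a uninorm on $L$ with neutral element $e$ if and only if $T_e(x,y)>0$ for all $x,y>0$ (with $x,y\in[0,e]$) and $S_e(x,y)<1$ for all $x,y<1$ (with $x,y\in[e,1]$). (ii) Let $T_e$ be a $t$-norm on $[0,e]$ and let $S_e$ be a $t$-conorm on $[e,1]$. Suppose $x\parallel y$ for all $x\in I_e$ and $y\in\,]0,e]$. Then the function $U_2^e:L^2\to L$ defined by $$U_2^e(x,y)=\begin{cases} T_e(x,y) & \text{if }(x,y)\in[0,e]^2,\\ S_e(x,y) & \text{if }(x,y)\in[e,1]^2,\\ x & \text{if }(x,y)\in I_e\times\,]e,1[\,\cup\, I_e\times\,]0,e],\\ y & \text{if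 }(x,y)\in\,]e,1[\,\times I_e\cup\,]0,e]\times I_e,\\ x\wedge y & \text{if }(x,y)\in I_e^2\cup I_e\times\{0\}\cup\{0\}\times I_e\cup\,]e,1[\,\times\{0\}\cup\{0\}\times\,]e,1[,\\ x\vee y & \text{otherwise}\end{cases}$$ is a uninorm on $L$ with neutral element $e$ if and only if $T_e(x,y)>0$ for all $x,y>0$ (with $x,y\in[0,e]$) and $S_e(x,y)<1$ for all $x,y<1$ (with $x,y\in[e,1]$).
   Context: A bounded lattice $(L,\leq,0,1)$ is a lattice with bottom element $0$ and top element $1$. For $a\le b$ in $L$: $[a,b]=\{x\in L: a\le x\le b\}$, $[a,b[\,=\{x: a\le x<b\}$, $]a,b]=\{x: a<x\le b\}$, $]a,b[\,=\{x: a<x<b\}$. Write $x\parallel y$ if $x$ and $y$ are incomparable, and $I_e=\{x\in L: x\parallel e\}$. A $t$-norm (resp. $t$-conorm) on a bounded lattice is a binary operation on it that is commutative, associative, increasing in both variables, and has the top (resp. bottom) element of that lattice as neutral element; so a $t$-norm on $[0,e]$ has neutral element $e$, and a $t$-conorm on $[e,1]$ has neutral element $e$. A uninorm on $L$ with neutral element $e\in L$ is a map $U:L^2\to L$ that is commutative, associative, increasing in both variables, and satisfies $U(e,x)=x$ for all $x\in L$.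
   Formalization: The "only if" is claimed in (i) only when I_e ∪ ]0,e[ is nonempty and in (ii) only when I_e ∪ ]e,1[ is nonempty; otherwise it fails, e.g. (i) on the chain 0<e<a<1 with S_e(a,a)=1. The "if" is proved in all cases. *)

theory Defs
  imports Main
begin

definition incomp :: "'a::order \<Rightarrow> 'a \<Rightarrow> bool" where
  "incomp x y \<longleftrightarrow> \<not> x \<le> y \<and> \<not> y \<le> x"

definition incomps :: "'a::order \<Rightarrow> 'a set" where
  "incomps e = {x. incomp x e}"

text \<open>A binary operation on a carrier \<open>A\<close> is represented by a total function on the ambient
  type. Only its values on \<open>A \<times> A\<close> are constrained, hence the explicit closure condition.\<close>

definition comm_assoc_incr_on :: "'a::order set \<Rightarrow> 'a \<Rightarrow> ('a \<Rightarrow> 'a \<Rightarrow> 'a) \<Rightarrow> bool" where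
  "comm_assoc_incr_on A n F \<longleftrightarrow>
     (\<forall>x\<in>A. \<forall>y\<in>A. F x y \<in> A) \<and>
     (\<forall>x\<in>A. \<forall>y\<in>A. F x y = F y x) \<and>
     (\<forall>x\<in>A. \<forall>y\<in>A. \<forall>z\<in>A. F (F x y) z = F x (F y z)) \<and>
     (\<forall>x\<in>A. \<forall>x'\<in>A. \<forall>y\<in>A. x \<le> x' \<longrightarrow> F x y \<le> F x' y) \<and>
     (\<forall>x\<in>A. \<forall>y\<in>A. \<forall>y'\<in>A. y \<le> y' \<longrightarrow> F x y \<le> F x y') \<and>
     (\<forall>x\<in>A. F n x = x)"

definition t_norm_on :: "'a::order \<Rightarrow> 'a \<Rightarrow> ('a \<Rightarrow> 'a \<Rightarrow> 'a) \<Rightarrow> bool" where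
  "t_norm_on a b T \<longleftrightarrow> comm_assoc_incr_on {a..b} b T"

definition t_conorm_on :: "'a::order \<Rightarrow> 'a \<Rightarrow> ('a \<Rightarrow> 'a \<Rightarrow> 'a) \<Rightarrow> bool" where
  "t_conorm_on a b S \<longleftrightarrow> comm_assoc_incr_on {a..b} a S"

definition uninorm :: "'a::bounded_lattice \<Rightarrow> ('a \<Rightarrow> 'a \<Rightarrow> 'a) \<Rightarrow> bool" where
  "uninorm e U \<longleftrightarrow> comm_assoc_incr_on UNIV e U"

text \<open>The first two cases below overlap only at \<open>(e, e)\<close>, where a t-norm on \<open>[bot, e]\<close> and a
  t-conorm on \<open>[e, top]\<close> both give \<open>e\<close>; no other cases overlap.\<close>

definition U1 :: "'a::bounded_lattice \<Rightarrow> ('a \<Rightarrow> 'a \<Rightarrow> 'a) \<Rightarrow> ('a \<Rightarrow> 'a \<Rightarrow> 'a) \<Rightarrow> 'a \<Rightarrow> 'a \<Rightarrow> 'a" where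
  "U1 e T S x y =
    (if (x, y) \<in> {bot..e} \<times> {bot..e} then T x y
     else if (x, y) \<in> {e..top} \<times> {e..top} then S x y
     else if (x, y) \<in> incomps e \<times> {e..<top} \<union> incomps e \<times> {bot<..<e} then x
     else if (x, y) \<in> {e..<top} \<times> incomps e \<union> {bot<..<e} \<times> incomps e then y
     else if (x, y) \<in> incomps e \<times> incomps e \<union> incomps e \<times> {top} \<union> {top} \<times> incomps e
                      \<union> {bot<..<e} \<times> {top} \<union> {top} \<times> {bot<..<e} then sup x y
     else inf x y)"

definition U2 :: "'a::bounded_lattice \<Rightarrow> ('a \<Rightarrow> 'a \<Rightarrow> 'a) \<Rightarrow> ('a \<Rightarrow> 'a \<Rightarrow> 'a) \<Rightarrow> 'a \<Rightarrow> 'a \<Rightarrow> 'a" where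
  "U2 e T S x y =
    (if (x, y) \<in> {bot..e} \<times> {bot..e} then T x y
     else if (x, y) \<in> {e..top} \<times> {e..top} then S x y
     else if (x, y) \<in> incomps e \<times> {e<..<top} \<union> incomps e \<times> {bot<..e} then x
     else if (x, y) \<in> {e<..<top} \<times> incomps e \<union> {bot<..e} \<times> incomps e then y
     else if (x, y) \<in> incomps e \<times> incomps e \<union> incomps e \<times> {bot} \<union> {bot} \<times> incomps e
                      \<union> {e<..<top} \<times> {bot} \<union> {bot} \<times> {e<..<top} then inf x y
     else sup x y)"

definition no_zero_divisors_below :: "'a::bounded_lattice \<Rightarrow> ('a \<Rightarrow> 'a \<Rightarrow> 'a) \<Rightarrow> bool" where
  "no_zero_divisors_below e T \<longleftrightarrow> (\<forall>x\<in>{bot..e}. \<forall>y\<in>{bot..e}. bot < x \<and> bot < y \<longrightarrow> bot < T x y)"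

definition no_one_divisors_above :: "'a::bounded_lattice \<Rightarrow> ('a \<Rightarrow> 'a \<Rightarrow> 'a) \<Rightarrow> bool" where
  "no_one_divisors_above e S \<longleftrightarrow> (\<forall>x\<in>{e..top}. \<forall>y\<in>{e..top}. x < top \<and> y < top \<longrightarrow> S x y < top)"

text \<open>Non-degeneracy in the theorem: if \<open>incomps e \<union> {bot<..<e} = {}\<close>, so that the lattice is
  \<open>{bot} \<union> [e, top]\<close>, then \<open>U1 e T S\<close> is a uninorm for every t-conorm \<open>S\<close>, and
  \<open>no_one_divisors_above e S\<close> is not necessary (take the chain \<open>bot < e < a < top\<close> with
  \<open>S a a = top\<close>). Dually, necessity in the second part fails if \<open>incomps e \<union> {e<..<top} = {}\<close>.
  The theorem therefore requires these sets to be nonempty, but only for necessity.\<close>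

end

theory Submission
  imports Defs "HOL-Library.Dual_Ordered_Lattice"
begin

text \<open>For part (i), \<open>bot\<close> annihilates everything and \<open>top\<close> annihilates everything else. On the
  remaining elements \<open>U1 e T S\<close> is an ordinal sum of three commutative semigroups: \<open>S\<close> on \<open>[e, top[\<close>,
  \<open>T\<close> on \<open>]bot, e[\<close> and the join on \<open>incomps e\<close>, a product of elements of different summands being
  the factor in the later one. The hypotheses on \<open>T\<close> and \<open>S\<close> say that the first two are closed;
  joins in \<open>incomps e\<close> either stay there or equal \<open>top\<close>, by the incomparability assumption. Conversely,
  a zero divisor \<open>T x y = bot\<close> makes \<open>U top (U x y) = bot\<close> but \<open>U (U top x) y = top\<close>, and
  \<open>S x y = top\<close> makes \<open>U z (U x y) = top\<close> but \<open>U (U z x) y = z\<close> for \<open>z\<close> in \<open>incomps e\<close> or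
  \<open>]bot, e[\<close>. Part (ii) is part (i) in the dual lattice, where \<open>T\<close> and \<open>S\<close> exchange their
  roles.\<close>

section \<open>The operation \<open>U\<close> and its multiplication table over five regions\<close>

locale norm_pair =
  fixes e :: "'a::bounded_lattice" and T S :: "'a \<Rightarrow> 'a \<Rightarrow> 'a"
  assumes e_neq_bot: "e \<noteq> bot" and e_neq_top: "e \<noteq> top"
    and t_norm: "t_norm_on bot e T" and t_conorm: "t_conorm_on e top S"
begin

lemma bot_neq_top: "bot \<noteq> (top :: 'a)"
  using e_neq_bot top_greatest[of e] bot_unique[of e] by metis

lemma T_commute: "x \<le> e \<Longrightarrow> y \<le> e \<Longrightarrow> T x y = T y x"
  and T_assoc: "x \<le> e \<Longrightarrow> y \<le> e \<Longrightarrow> z \<le> e \<Longrightarrow> T (T x y) z = T x (T y z)"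
  and T_mono: "x \<le> x' \<Longrightarrow> x' \<le> e \<Longrightarrow> y \<le> e \<Longrightarrow> T x y \<le> T x' y"
  and T_neutral: "x \<le> e \<Longrightarrow> T e x = x"
  using t_norm order_trans[of x x' e]
  by (auto simp: t_norm_on_def comm_assoc_incr_on_def)

lemma S_ge: "e \<le> x \<Longrightarrow> e \<le> y \<Longrightarrow> e \<le> S x y"
  and S_commute: "e \<le> x \<Longrightarrow> e \<le> y \<Longrightarrow> S x y = S y x"
  and S_assoc: "e \<le> x \<Longrightarrow> e \<le> y \<Longrightarrow> e \<le> z \<Longrightarrow> S (S x y) z = S x (S y z)"
  and S_mono: "x \<le> x' \<Longrightarrow> e \<le> x \<Longrightarrow> e \<le> y \<Longrightarrow> S x y \<le> S x' y"
  and S_neutral: "e \<le> x \<Longrightarrow> S e x = x"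
  using t_conorm order_trans[of e x x']
  by (auto simp: t_conorm_on_def comm_assoc_incr_on_def)

lemma T_le_right: "x \<le> e \<Longrightarrow> y \<le> e \<Longrightarrow> T x y \<le> y"
  using T_mono[of x e y] by (simp add: T_neutral)

lemma T_le_left: "x \<le> e \<Longrightarrow> y \<le> e \<Longrightarrow> T x y \<le> x"
  using T_le_right[of y x] by (simp add: T_commute)

lemma S_ge_right: "e \<le> x \<Longrightarrow> e \<le> y \<Longrightarrow> y \<le> S x y"
  using S_mono[of e x y] by (simp add: S_neutral)

lemma S_ge_left: "e \<le> x \<Longrightarrow> e \<le> y \<Longrightarrow> x \<le> S x y"
  using S_ge_right[of y x] by (simp add: S_commute)

abbreviation U where "U \<equiv> U1 e T S"

text \<open>Counting \<open>e\<close> in the upper region makes the five cases disjoint and spares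
  the neutral element a case of its own.\<close>

lemma region_cases:
  obtains "x = bot" | "x \<in> {bot<..<e}" | "x \<in> {e..<top}" | "x = top" | "x \<in> incomps e"
  by (auto simp: incomps_def incomp_def less_le)

lemma U_commute: "U x y = U y x"
proof -
  have "T y x = T x y" if "x \<le> e" "y \<le> e"
    using that by (rule T_commute[symmetric])
  moreover have "S y x = S x y" if "e \<le> x" "e \<le> y"
    using that by (rule S_commute[symmetric])
  ultimately show ?thesis
    by (cases x rule: region_cases; cases y rule: region_cases)
      (simp_all add: U1_def incomps_def incomp_def less_le inf_commute sup_commute)
qed

text \<open>If \<open>x \<le> e\<close>, then \<open>T bot x \<le> bot\<close>; every other pair
  with first factor \<open>bot\<close> falls through to the closing meet case.\<close>

lemma U_bot_left: "U bot x = bot"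
  using e_neq_bot T_le_left[of bot x]
  by (auto simp: U1_def incomps_def incomp_def bot_unique less_le)

lemma U_bot_right: "U x bot = bot"
  using U_bot_left[of x] by (simp add: U_commute)

text \<open>If \<open>e \<le> x\<close>, then \<open>S top x\<close> is at least \<open>top\<close>;
  every other \<open>x\<close> distinct from \<open>bot\<close> is caught by the join case.\<close>

lemma U_top_left: "x \<noteq> bot \<Longrightarrow> U top x = top"
  using e_neq_bot e_neq_top S_ge_left[of top x]
  by (auto simp: U1_def incomps_def incomp_def top_unique bot_less less_le sup_absorb1)

lemma U_top_right: "x \<noteq> bot \<Longrightarrow> U x top = top"
  using U_top_left[of x] by (simp add: U_commute)

lemma U_eq_T: "x \<le> e \<Longrightarrow> y \<le> e \<Longrightarrow> U x y = T x y"
  by (simp add: U1_def)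

lemma U_below: "x \<in> {bot<..<e} \<Longrightarrow> y \<in> {bot<..<e} \<Longrightarrow> U x y = T x y"
  by (simp add: U_eq_T less_imp_le)

lemma U_above: "x \<in> {e..<top} \<Longrightarrow> y \<in> {e..<top} \<Longrightarrow> U x y = S x y"
  \<comment> \<open>The pair \<open>(e, e)\<close> is caught by the t-norm case, where
    \<open>T e e = e = S e e\<close>.\<close>
  using T_neutral[of e] S_neutral[of e] by (auto simp: U1_def)

lemma U_incomps: "x \<in> incomps e \<Longrightarrow> y \<in> incomps e \<Longrightarrow> U x y = sup x y"
  by (auto simp: U1_def incomps_def incomp_def less_le)

lemma U_below_above: "x \<in> {bot<..<e} \<Longrightarrow> y \<in> {e..<top} \<Longrightarrow> U x y = x"
  \<comment> \<open>At \<open>y = e\<close> the t-norm case gives \<open>T x e = x\<close>; for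
    larger \<open>y\<close> the closing case gives the meet, again \<open>x\<close>.\<close>
  using T_neutral[of x] T_commute[of x e]
  by (auto simp: U1_def incomps_def incomp_def less_le inf_absorb1)

lemma U_above_below: "x \<in> {e..<top} \<Longrightarrow> y \<in> {bot<..<e} \<Longrightarrow> U x y = y"
  by (subst U_commute) (rule U_below_above)

lemma U_incomps_left: "x \<in> incomps e \<Longrightarrow> y \<in> {bot<..<e} \<union> {e..<top} \<Longrightarrow> U x y = x"
  by (auto simp: U1_def incomps_def incomp_def less_le)

lemma U_incomps_right: "y \<in> incomps e \<Longrightarrow> x \<in> {bot<..<e} \<union> {e..<top} \<Longrightarrow> U x y = y"
  by (subst U_commute) (rule U_incomps_left)

lemmas U_simps = U_bot_left U_bot_right U_top_left U_top_right U_below U_above U_incomps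
  U_below_above U_above_below U_incomps_left U_incomps_right

lemma U_neutral: "U e x = x"
  using e_neq_bot e_neq_top
  by (cases x rule: region_cases) (simp_all add: U_simps less_top S_neutral)


section \<open>Necessity of the two divisor conditions\<close>

lemma U_assoc_if_uninorm: "uninorm e U \<Longrightarrow> U (U x y) z = U x (U y z)"
  unfolding uninorm_def comm_assoc_incr_on_def by (meson UNIV_I)

lemma no_zero_divisors_if_uninorm:
  assumes "uninorm e U"
  shows "no_zero_divisors_below e T"
  unfolding no_zero_divisors_below_def
proof (intro ballI impI)
  fix x y assume x: "x \<in> {bot..e}" and y: "y \<in> {bot..e}" and pos: "bot < x \<and> bot < y"
  have "U top (T x y) = U top (U x y)"
    using x y by (simp add: U_eq_T)
  also have "\<dots> = U (U top x) y"
    by (simp add: U_assoc_if_uninorm[OF assms])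
  also have "\<dots> = top"
    using pos by (auto simp: U_top_left)
  finally have "T x y \<noteq> bot"
    using U_bot_right[of top] bot_neq_top by auto
  then show "bot < T x y"
    by (simp add: bot_less)
qed

text \<open>The nonemptiness assumption provides an element that is fixed under multiplication by
  all of \<open>[e, top[\<close> but not by \<open>top\<close>; this tells \<open>S x y\<close>
  apart from \<open>top\<close>.\<close>

lemma no_one_divisors_if_uninorm:
  assumes "uninorm e U" and "incomps e \<union> {bot<..<e} \<noteq> {}"
  shows "no_one_divisors_above e S"
  unfolding no_one_divisors_above_def
proof (intro ballI impI)
  fix x y assume x: "x \<in> {e..top}" and y: "y \<in> {e..top}" and lt: "x < top \<and> y < top"
  obtain z where z: "z \<in> incomps e \<union> {bot<..<e}"
    using assms(2) by blast
  have absorb: "U z w = z" if "w \<in> {e..<top}" for w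
    using z that by (auto simp: U_below_above U_incomps_left)
  have z_neq: "z \<noteq> bot" "z \<noteq> top"
    using z by (auto simp: incomps_def incomp_def top_unique)
  have "U z (S x y) = U z (U x y)"
    using x y lt by (simp add: U_above)
  also have "\<dots> = U (U z x) y"
    by (simp add: U_assoc_if_uninorm[OF assms(1)])
  also have "\<dots> = z"
    using x y lt by (simp add: absorb)
  finally have "S x y \<noteq> top"
    using z_neq U_top_right[of z] by auto
  then show "S x y < top"
    by (simp add: less_top)
qed

end

section \<open>Sufficiency: associativity and monotonicity in the absence of divisors\<close>

locale norm_pair_without_divisors = norm_pair +
  assumes incomps_apart: "\<forall>x\<in>incomps e. \<forall>y\<in>{e..<top}. incomp x y"
    and no_zero_divisors: "no_zero_divisors_below e T"
    and no_one_divisors: "no_one_divisors_above e S"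
begin

lemma T_pos: "bot < x \<Longrightarrow> x < e \<Longrightarrow> bot < y \<Longrightarrow> y < e \<Longrightarrow> bot < T x y"
  using no_zero_divisors by (auto simp: no_zero_divisors_below_def)

lemma T_less: "x < e \<Longrightarrow> y < e \<Longrightarrow> T x y < e"
  by (meson T_le_left le_less_trans less_imp_le)

lemma S_less: "e \<le> x \<Longrightarrow> x < top \<Longrightarrow> e \<le> y \<Longrightarrow> y < top \<Longrightarrow> S x y < top"
  using no_one_divisors by (auto simp: no_one_divisors_above_def)

text \<open>A join in \<open>[e, top[\<close> would have to be incomparable to \<open>x\<close>,
  although it lies above \<open>x\<close>; and it cannot lie below \<open>e\<close>, since
  \<open>x\<close> does not.\<close>

lemma sup_incomps:
  assumes "x \<in> incomps e" "y \<in> incomps e"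
  shows "sup x y \<in> incomps e \<or> sup x y = top"
proof (rule disjCI)
  assume "sup x y \<noteq> top"
  then have "incomp x (sup x y)" if "e \<le> sup x y"
    using incomps_apart assms(1) that by (simp add: less_top)
  then have "\<not> e \<le> sup x y"
    by (auto simp: incomp_def)
  moreover have "\<not> sup x y \<le> e"
    using assms(1) by (simp add: incomps_def incomp_def)
  ultimately show "sup x y \<in> incomps e"
    by (simp add: incomps_def incomp_def)
qed

lemma incomps_neq_bot: "x \<in> incomps e \<Longrightarrow> x \<noteq> bot"
  by (auto simp: incomps_def incomp_def)

text \<open>If the join \<open>sup x y\<close> escapes to \<open>top\<close>, both sides are
  \<open>top\<close>.\<close>

lemma U_sup_incomps_incomps:
  assumes "x \<in> incomps e" "y \<in> incomps e" "z \<in> incomps e"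
  shows "U (sup x y) z = sup (sup x y) z"
  using sup_incomps[OF assms(1,2)] assms(3)
  by (auto simp: U_incomps U_top_left incomps_neq_bot)

lemma U_sup_incomps_left:
  assumes "x \<in> incomps e" "y \<in> incomps e" "z \<in> {bot<..<e} \<union> {e..<top}"
  shows "U (sup x y) z = sup x y"
proof -
  have "z \<noteq> bot"
    using assms(3) e_neq_bot by (auto simp: bot_unique)
  then show ?thesis
    using sup_incomps[OF assms(1,2)] assms(3)
    by (elim disjE) (simp_all only: U_incomps_left U_top_left not_False_eq_True)
qed

lemmas U_sup_left_simps = U_sup_incomps_incomps U_sup_incomps_left

text \<open>Commutativity supplies the mirror images, with the join as right factor.\<close>

lemmas U_sup_simps = U_sup_left_simps U_sup_left_simps[THEN trans[OF U_commute]]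

text \<open>Keeps inner products away from \<open>bot\<close>, so that \<open>top\<close> still
  absorbs them in the proof of associativity. The critical case is a product inside
  \<open>]bot, e[\<close>, settled by \<open>T_pos\<close>.\<close>

lemma U_neq_bot:
  assumes "x \<noteq> bot" "y \<noteq> bot"
  shows "U x y \<noteq> bot"
proof -
  have "S x y \<noteq> bot" if "e \<le> x" "e \<le> y"
    using S_ge[OF that] e_neq_bot by (auto simp: bot_unique)
  moreover have "sup x y \<noteq> bot"
    using assms by (simp add: sup_eq_bot_iff)
  moreover have "T x y \<noteq> bot" if "bot < x" "x < e" "bot < y" "y < e"
    using T_pos[OF that] by simp
  ultimately show ?thesis
    using assms bot_neq_top
    by (cases x rule: region_cases; cases y rule: region_cases) (simp_all add: U_simps)
qed

lemma T_below: "x \<in> {bot<..<e} \<Longrightarrow> y \<in> {bot<..<e} \<Longrightarrow> T x y \<in> {bot<..<e}"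
  using T_pos T_less by simp

lemma S_above: "x \<in> {e..<top} \<Longrightarrow> y \<in> {e..<top} \<Longrightarrow> S x y \<in> {e..<top}"
  using S_ge S_less by simp

lemma T_assoc_below:
  "x \<in> {bot<..<e} \<Longrightarrow> y \<in> {bot<..<e} \<Longrightarrow> z \<in> {bot<..<e} \<Longrightarrow> T (T x y) z = T x (T y z)"
  by (intro T_assoc) (auto simp: less_imp_le)

lemma S_assoc_above:
  "x \<in> {e..<top} \<Longrightarrow> y \<in> {e..<top} \<Longrightarrow> z \<in> {e..<top} \<Longrightarrow> S (S x y) z = S x (S y z)"
  by (intro S_assoc) auto

text \<open>Both sides retain only the factors from the latest summand that occurs, multiplied
  there; the summands are ordered \<open>[e, top[\<close>, \<open>]bot, e[\<close>,
  \<open>incomps e\<close>. Joins that reach \<open>top\<close> are covered by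
  \<open>U_sup_simps\<close>.\<close>

lemma U_assoc_interior:
  assumes "x \<in> {bot<..<e} \<union> {e..<top} \<union> incomps e"
    and "y \<in> {bot<..<e} \<union> {e..<top} \<union> incomps e"
    and "z \<in> {bot<..<e} \<union> {e..<top} \<union> incomps e"
  shows "U (U x y) z = U x (U y z)"
  using assms
  by (elim UnE)
    (simp_all only: Un_iff simp_thms U_below U_above U_incomps U_below_above U_above_below
      U_incomps_left U_incomps_right U_sup_simps T_below S_above T_assoc_below S_assoc_above
      sup.assoc sup.commute sup.left_commute)

text \<open>A factor \<open>bot\<close> makes both sides \<open>bot\<close>; failing that, a factor
  \<open>top\<close> makes both sides \<open>top\<close>, since inner products are not
  \<open>bot\<close> by \<open>U_neq_bot\<close>.\<close>

lemma U_assoc: "U (U x y) z = U x (U y z)"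
proof -
  consider "x = bot \<or> y = bot \<or> z = bot"
    | "x \<noteq> bot" "y \<noteq> bot" "z \<noteq> bot" "x = top \<or> y = top \<or> z = top"
    | "bot \<notin> {x, y, z}" "top \<notin> {x, y, z}"
    by blast
  then show ?thesis
  proof cases
    case 1
    then show ?thesis
      by (elim disjE) (simp_all only: U_bot_left U_bot_right)
  next
    case 2
    then show ?thesis
      using U_neq_bot by (elim disjE)
        (simp_all only: U_top_left U_top_right bot_neq_top not_False_eq_True)
  next
    case 3
    then show ?thesis
      by (intro U_assoc_interior) (auto simp: incomps_def incomp_def less_le)
  qed
qed

lemma U_mono_interior:
  assumes "x \<in> {bot<..<e} \<union> {e..<top} \<union> incomps e"
    and "x' \<in> {bot<..<e} \<union> {e..<top} \<union> incomps e"
    and "y \<in> {bot<..<e} \<union> {e..<top} \<union> incomps e"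
    and "x \<le> x'"
  shows "U x y \<le> U x' y"
proof -
  \<comment> \<open>If \<open>x \<le> x'\<close>, then both share a region or \<open>x\<close> is in
    \<open>]bot, e[\<close>. That nothing in \<open>incomps e\<close> lies below an element of
    \<open>[e, top[\<close> is \<open>incomps_apart\<close>; the other exclusions are
    transitivity.\<close>
  have "x' \<notin> {e..<top}" if "x \<in> incomps e"
    using incomps_apart that assms(4) unfolding incomp_def by blast
  moreover have "x' \<notin> {bot<..<e}" if "x \<in> incomps e"
    using that order_trans[OF assms(4), of e] by (auto simp: incomps_def incomp_def less_imp_le)
  moreover have "x' \<notin> {bot<..<e} \<union> incomps e" if "x \<in> {e..<top}"
    using that order_trans[of e x x'] assms(4) by (auto simp: incomps_def incomp_def)
  ultimately consider "x \<in> {bot<..<e}" "x' \<in> {bot<..<e}"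
    | "x \<in> {bot<..<e}" "x' \<in> {e..<top}" | "x \<in> {bot<..<e}" "x' \<in> incomps e"
    | "x \<in> {e..<top}" "x' \<in> {e..<top}" | "x \<in> incomps e" "x' \<in> incomps e"
    using assms(1,2) by blast
  then show ?thesis
  proof cases
    case 1
    then show ?thesis
      using assms(3,4) by (elim UnE) (simp_all add: U_simps T_mono less_imp_le)
  next
    case 2
    then have le: "x \<le> e" "e \<le> x'"
      by (simp_all add: less_imp_le)
    \<comment> \<open>For \<open>y\<close> in \<open>]bot, e[\<close> the right side is
      \<open>y\<close>, for \<open>y\<close> in \<open>[e, top[\<close> the left side is
      \<open>x\<close>, and for \<open>y\<close> in \<open>incomps e\<close> both sides are
      \<open>y\<close>.\<close>
    have "T x y \<le> y" if "y \<le> e"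
      using le(1) that by (rule T_le_right)
    moreover have "x \<le> S x' y" if "e \<le> y"
      using assms(4) S_ge_left[OF le(2) that] by (rule order_trans)
    ultimately show ?thesis
      using 2 assms(3) by (elim UnE) (simp_all add: U_simps less_imp_le)
  next
    case 3
    \<comment> \<open>The right side is \<open>x'\<close>, except for \<open>y\<close> in
      \<open>incomps e\<close>, where \<open>y\<close> is compared with
      \<open>sup x' y\<close>.\<close>
    then have "T x y \<le> x'" if "y \<le> e"
      using T_le_left[of x y] that assms(4) by (auto simp: less_imp_le intro: order_trans)
    then show ?thesis
      using 3 assms(3,4) by (elim UnE) (simp_all add: U_simps less_imp_le)
  next
    case 4
    then show ?thesis
      using assms(3,4) by (elim UnE) (simp_all add: U_simps S_mono)
  next
    case 5
    then show ?thesis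
      using assms(3,4) by (elim UnE) (simp_all add: U_simps le_supI1)
  qed
qed

lemma U_mono:
  assumes "x \<le> x'"
  shows "U x y \<le> U x' y"
proof -
  \<comment> \<open>As \<open>x = top\<close> forces \<open>x' = top\<close> and
    \<open>x' = bot\<close> forces \<open>x = bot\<close>, every boundary case has left side
    \<open>bot\<close> or right side \<open>top\<close>.\<close>
  consider "x = bot \<or> y = bot" | "x \<noteq> bot" "y \<noteq> bot" "x' \<noteq> bot" "x' = top \<or> y = top"
    | "bot \<notin> {x, x', y}" "top \<notin> {x, x', y}"
    using assms bot_unique[of x] top_unique[of x'] by blast
  then show ?thesis
  proof cases
    case 1
    then show ?thesis
      by (elim disjE) (simp_all add: U_bot_left U_bot_right)
  next
    case 2
    then show ?thesis
      by (elim disjE) (simp_all only: U_top_left U_top_right not_False_eq_True top_greatest order_refl)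
  next
    case 3
    then show ?thesis
      using assms by (intro U_mono_interior) (auto simp: incomps_def incomp_def less_le)
  qed
qed

lemma uninorm_U1: "uninorm e U"
  unfolding uninorm_def comm_assoc_incr_on_def
proof (intro conjI ballI impI)
  show "U x y \<le> U x y'" if "y \<le> y'" for x y y'
    using U_mono[OF that] by (simp only: U_commute[of x])
qed (rule UNIV_I U_assoc U_neutral U_commute U_mono | assumption)+

end

section \<open>Transport to the dual lattice\<close>

definition dual_op :: "('a \<Rightarrow> 'a \<Rightarrow> 'a) \<Rightarrow> 'a dual \<Rightarrow> 'a dual \<Rightarrow> 'a dual" where
  "dual_op F x y = dual (F (undual x) (undual y))"

lemma all_dual: "(\<forall>x. P x) \<longleftrightarrow> (\<forall>x. P (dual x))"
  by (metis dual_undual)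

text \<open>Reversing the order only exchanges the two arguments compared in each monotonicity law;
  the remaining laws do not mention the order.\<close>

lemma comm_assoc_incr_on_dual_op:
  assumes "\<And>x. dual x \<in> B \<longleftrightarrow> x \<in> A"
  shows "comm_assoc_incr_on B (dual n) (dual_op F) \<longleftrightarrow> comm_assoc_incr_on A n F"
  by (auto simp: comm_assoc_incr_on_def Ball_def all_dual assms dual_op_def)

lemma dual_mem_interval:
  "dual x \<in> {dual b..dual a} \<longleftrightarrow> x \<in> {a..b}"
  "dual x \<in> {dual b..<dual a} \<longleftrightarrow> x \<in> {a<..b}"
  "dual x \<in> {dual b<..<dual a} \<longleftrightarrow> x \<in> {a<..<b}"
  by auto

lemma uninorm_dual_op: "uninorm (dual e) (dual_op U) \<longleftrightarrow> uninorm e U"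
  unfolding uninorm_def by (rule comm_assoc_incr_on_dual_op) simp

lemma t_norm_on_dual_op: "t_norm_on (dual b) (dual a) (dual_op S) \<longleftrightarrow> t_conorm_on a b S"
  unfolding t_norm_on_def t_conorm_on_def by (rule comm_assoc_incr_on_dual_op) auto

lemma t_conorm_on_dual_op: "t_conorm_on (dual b) (dual a) (dual_op T) \<longleftrightarrow> t_norm_on a b T"
  unfolding t_norm_on_def t_conorm_on_def by (rule comm_assoc_incr_on_dual_op) auto

lemma incomp_dual: "incomp (dual x) (dual y) \<longleftrightarrow> incomp x y"
  by (auto simp: incomp_def)

lemma dual_mem_incomps: "dual x \<in> incomps (dual e) \<longleftrightarrow> x \<in> incomps e"
  by (simp add: incomps_def incomp_dual)

lemma no_zero_divisors_dual_op:
  "no_zero_divisors_below (dual e) (dual_op S) \<longleftrightarrow> no_one_divisors_above e S"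
  by (auto simp: no_zero_divisors_below_def no_one_divisors_above_def Ball_def all_dual dual_op_def
      simp flip: dual_top_eq)

lemma no_one_divisors_dual_op:
  "no_one_divisors_above (dual e) (dual_op T) \<longleftrightarrow> no_zero_divisors_below e T"
  by (auto simp: no_zero_divisors_below_def no_one_divisors_above_def Ball_def all_dual dual_op_def
      simp flip: dual_bot_eq)

text \<open>In the dual lattice the clauses of \<open>U1\<close> become those of \<open>U2\<close>,
  but with the first two tested in the opposite order. These overlap only at \<open>(e, e)\<close>,
  where both operations give \<open>e\<close>; this is what \<open>norm_pair\<close> is used
  for.\<close>

lemma U1_dual_op:
  fixes e :: "'a::bounded_lattice"
  assumes "norm_pair e T S"
  shows "U1 (dual e) (dual_op S) (dual_op T) = dual_op (U2 e T S)"
proof (intro ext)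
  interpret norm_pair e T S by (fact assms)
  fix x y :: "'a dual"
  obtain a b where "x = dual a" "y = dual b"
    by (metis dual_undual)
  moreover have "U1 (dual e) (dual_op S) (dual_op T) (dual a) (dual b) = dual (U2 e T S a b)"
  proof (cases "a \<in> {bot..e} \<and> b \<in> {bot..e}"; cases "a \<in> {e..top} \<and> b \<in> {e..top}")
    assume "a \<in> {bot..e} \<and> b \<in> {bot..e}" "a \<in> {e..top} \<and> b \<in> {e..top}"
    then have "a = e" "b = e"
      by auto
    then show ?thesis
      using T_neutral[of e] S_neutral[of e] by (simp add: U1_def U2_def dual_op_def)
  qed (simp_all only: U1_def U2_def dual_op_def mem_Times_iff Un_iff prod.sel undual_dual
      singleton_iff dual_mem_incomps dual_mem_interval dual_top_eq[symmetric] dual_bot_eq[symmetric]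
      eq_dual_iff dual_sup_eq[symmetric] dual_inf_eq[symmetric] if_distrib[of dual] disj_ac
      if_True if_False simp_thms)
  ultimately show "U1 (dual e) (dual_op S) (dual_op T) x y = dual_op (U2 e T S) x y"
    by (simp add: dual_op_def)
qed

lemma norm_pair_dual_op:
  assumes "norm_pair e T S"
  shows "norm_pair (dual e) (dual_op S) (dual_op T)"
  using assms t_norm_on_dual_op[of top e S] t_conorm_on_dual_op[of e bot T]
  by (simp add: norm_pair_def flip: dual_top_eq dual_bot_eq)

section \<open>Assembly of both parts\<close>

lemma uninorm_U1_if_no_divisors:
  assumes "norm_pair e T S" and "\<forall>x\<in>incomps e. \<forall>y\<in>{e..<top}. incomp x y"
    and "no_zero_divisors_below e T" and "no_one_divisors_above e S"
  shows "uninorm e (U1 e T S)"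
proof -
  interpret norm_pair_without_divisors e T S
    using assms by (simp add: norm_pair_without_divisors_def norm_pair_without_divisors_axioms_def)
  show ?thesis
    by (rule uninorm_U1)
qed

lemma uninorm_U1_iff:
  assumes "norm_pair e T S" and "\<forall>x\<in>incomps e. \<forall>y\<in>{e..<top}. incomp x y"
    and "incomps e \<union> {bot<..<e} \<noteq> {}"
  shows "uninorm e (U1 e T S) \<longleftrightarrow> no_zero_divisors_below e T \<and> no_one_divisors_above e S"
  using uninorm_U1_if_no_divisors[OF assms(1,2)]
    norm_pair.no_zero_divisors_if_uninorm[OF assms(1)]
    norm_pair.no_one_divisors_if_uninorm[OF assms(1) _ assms(3)] by blast

theorem theorem4p1:
  fixes e :: "'a::bounded_lattice"
    and T S :: "'a \<Rightarrow> 'a \<Rightarrow> 'a"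
  assumes e: "e \<noteq> bot" "e \<noteq> top"
    and T: "t_norm_on bot e T"
    and S: "t_conorm_on e top S"
  shows
    "((\<forall>x\<in>incomps e. \<forall>y\<in>{e..<top}. incomp x y) \<longrightarrow>
        (incomps e \<union> {bot<..<e} \<noteq> {} \<longrightarrow>
           (uninorm e (U1 e T S) \<longleftrightarrow> no_zero_divisors_below e T \<and> no_one_divisors_above e S)) \<and>
        (no_zero_divisors_below e T \<and> no_one_divisors_above e S \<longrightarrow> uninorm e (U1 e T S))) \<and>
     ((\<forall>x\<in>incomps e. \<forall>y\<in>{bot<..e}. incomp x y) \<longrightarrow>
        (incomps e \<union> {e<..<top} \<noteq> {} \<longrightarrow>
           (uninorm e (U2 e T S) \<longleftrightarrow> no_zero_divisors_below e T \<and> no_one_divisors_above e S)) \<and>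
        (no_zero_divisors_below e T \<and> no_one_divisors_above e S \<longrightarrow> uninorm e (U2 e T S)))"
proof -
  have pair: "norm_pair e T S"
    using assms by (simp add: norm_pair_def)
  note dual_pair = norm_pair_dual_op[OF pair]
  \<comment> \<open>Under \<open>dual\<close>, \<open>]bot, e]\<close> becomes
    \<open>[dual e, top[\<close> and \<open>]e, top[\<close> becomes \<open>]bot, dual e[\<close>,
    so the hypotheses of part (ii) turn into those of part (i).\<close>
  have apart: "\<forall>x\<in>incomps (dual e). \<forall>y\<in>{dual e..<top}. incomp x y"
    if "\<forall>x\<in>incomps e. \<forall>y\<in>{bot<..e}. incomp x y"
    using that unfolding Ball_def all_dual[where 'a = 'a] dual_bot_eq[symmetric]
    by (simp only: dual_mem_incomps dual_mem_interval incomp_dual simp_thms)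
  have nonempty: "incomps (dual e) \<union> {bot<..<dual e} \<noteq> {}" if "incomps e \<union> {e<..<top} \<noteq> {}"
  proof -
    obtain z where "z \<in> incomps e \<or> z \<in> {e<..<top}"
      using \<open>incomps e \<union> {e<..<top} \<noteq> {}\<close> by blast
    then have "dual z \<in> incomps (dual e) \<or> dual z \<in> {bot<..<dual e}"
      by (simp only: dual_mem_incomps dual_mem_interval flip: dual_top_eq)
    then show ?thesis
      by blast
  qed
  \<comment> \<open>These rewrite part (i) for the dual lattice into statements about
    \<open>U2\<close>; the two divisor conditions come back exchanged.\<close>
  note dual_iffs = U1_dual_op[OF pair] uninorm_dual_op no_zero_divisors_dual_op
    no_one_divisors_dual_op
  show ?thesis
    using uninorm_U1_if_no_divisors[OF pair] uninorm_U1_iff[OF pair]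
      uninorm_U1_if_no_divisors[OF dual_pair apart, unfolded dual_iffs]
      uninorm_U1_iff[OF dual_pair apart nonempty, unfolded dual_iffs]
    by blast
qed

end
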